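(* Consider the problem (QCQP) $$\min_{X\in\mathcal{D}}\{\langle A_0,X\rangle:\ b_i^l\le\langle A_i,X\rangle\le b_i^u,\ \forall i\in[m]\},\qquad\mathcal{D}:=\{X\in\mathcal{S}_+^n:\ \operatorname{rank}(X)\le1\},$$ and its semidefinite relaxation (QCQP-R) $$V_{\rm rel}:=\min_{X\in\operatorname{conv}(\mathcal{D})}\{\langle A_0,X\rangle:\ b_i^l\le\langle A_i,X\rangle\le b_i^u,\ \forall i\in[m]\},\qquad \operatorname{conv}(\mathcal{D})=\mathcal{S}_+^n.$$ Let $\tilde m$ be the number of linearly independent matrices among $A_1,\dots,A_m$. Then there exists an optimal solution of QCQP-R with rank at most $1+\lfloor\sqrt{2\tilde m+1/4}-3/2\rfloor$ if $V_{\rm rel}>-\infty$. Besides, if $\tilde m\le2$, then QCQP-R achieves the same optimal value as QCQP if $V_{\rm rel}>-\infty$.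
   Context: $n$ is a positive integer; $[m]=\{1,\dots,m\}$; $\mathcal{S}_+^n$ is the set of $n\times n$ real symmetric positive semidefinite matrices; $\langle\cdot,\cdot\rangle$ is the Frobenius inner product; $\operatorname{conv}$ denotes convex hull. $A_0,A_1,\dots,A_m$ are real symmetric $n\times n$ matrices and $-\infty\le b_i^l\le b_i^u\le+\infty$. The number $\tilde m$ is the dimension of the linear span of $\{A_i\}_{i\in[m]}$.
   Formalization: The rank bound is stated under the added assumption that QCQP-R attains its minimum, since V_rel > -∞ alone does not give an optimal solution (e.g. minimise X_11 over 2×2 PSD X with X_12 = 1, or an infeasible problem). *)

theory Defs
  imports "HOL-Analysis.Analysis" "HOL-Library.Extended_Real"
begin

definition psd_matrices :: "(real^'n^'n) set" where
  "psd_matrices = {X. transpose X = X \<and> (\<forall>v. 0 \<le> v \<bullet> (X *v v))}"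

definition rank_one_domain :: "(real^'n^'n) set" where
  "rank_one_domain = {X \<in> psd_matrices. rank X \<le> 1}"

text \<open>
  The matrices \<open>A 1, \<dots>, A m\<close> are the constraint matrices; \<open>A 0\<close> is reserved for the objective.
  The inner product \<open>\<bullet>\<close> on \<open>real^'n^'n\<close> is the entrywise one, i.e. the Frobenius inner product.
  The bounds are extended reals, so one-sided constraints are allowed.
\<close>

definition feasible_set ::
  "(real^'n^'n) set \<Rightarrow> nat \<Rightarrow> (nat \<Rightarrow> real^'n^'n) \<Rightarrow> (nat \<Rightarrow> ereal) \<Rightarrow> (nat \<Rightarrow> ereal)
    \<Rightarrow> (real^'n^'n) set" where
  "feasible_set D m A bl bu =
     {X \<in> D. \<forall>i\<in>{1..m}. bl i \<le> ereal (A i \<bullet> X) \<and> ereal (A i \<bullet> X) \<le> bu i}"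

text \<open>
  The infimum in the extended reals: \<open>\<infinity>\<close> if the problem is infeasible, \<open>-\<infinity>\<close> if it is unbounded.
\<close>

definition optimal_value ::
  "(real^'n^'n) set \<Rightarrow> nat \<Rightarrow> (nat \<Rightarrow> real^'n^'n) \<Rightarrow> (nat \<Rightarrow> ereal) \<Rightarrow> (nat \<Rightarrow> ereal) \<Rightarrow> ereal" where
  "optimal_value D m A bl bu = (INF X \<in> feasible_set D m A bl bu. ereal (A 0 \<bullet> X))"

definition optimal_solution ::
  "(real^'n^'n) set \<Rightarrow> nat \<Rightarrow> (nat \<Rightarrow> real^'n^'n) \<Rightarrow> (nat \<Rightarrow> ereal) \<Rightarrow> (nat \<Rightarrow> ereal)
    \<Rightarrow> real^'n^'n \<Rightarrow> bool" where
  "optimal_solution D m A bl bu X \<longleftrightarrow>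
     is_arg_min (\<lambda>Y. A 0 \<bullet> Y) (\<lambda>Y. Y \<in> feasible_set D m A bl bu) X"

text \<open>
  A finite optimal value of a semidefinite program need not be attained: minimising \<open>X\<^sub>1\<^sub>1\<close> over
  positive semidefinite 2-by-2 matrices with \<open>X\<^sub>1\<^sub>2 = 1\<close> has value \<open>0\<close> but no minimiser. Since the
  value of a problem is an infimum here, that it is a minimum has to be said separately.
\<close>

definition attains_minimum ::
  "(real^'n^'n) set \<Rightarrow> nat \<Rightarrow> (nat \<Rightarrow> real^'n^'n) \<Rightarrow> (nat \<Rightarrow> ereal) \<Rightarrow> (nat \<Rightarrow> ereal) \<Rightarrow> bool" where
  "attains_minimum D m A bl bu \<longleftrightarrow> (\<exists>X. optimal_solution D m A bl bu X)"

end

theory Submission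
  imports Defs
begin

text \<open>
  The proof is a rank reduction in the manner of Barvinok and Pataki. Let \<open>X\<close> be a feasible point of
  the relaxation and \<open>r = rank X\<close>. The symmetric matrices that vanish on the kernel of \<open>X\<close> form a
  space of dimension \<open>r (r + 1) / 2\<close>. If this exceeds the dimension of the span of the constraint
  matrices, then some nonzero \<open>W\<close> in that space is orthogonal to all of them, and moving along \<open>W\<close>
  or \<open>- W\<close> changes no constraint value. Of the two directions, one leaves the cone and does not
  increase the objective: a direction that stays in the cone forever cannot decrease an objective
  that is bounded below, and \<open>W\<close> and \<open>- W\<close> cannot both stay. Following it up to the boundary of
  the cone gives a feasible point of smaller rank that is no worse
  (\<open>psd_move_to_lower_rank\<close>). Hence every feasible point can be replaced by one that is no worse
  and has \<open>r (r + 1) \<le> 2 m'\<close>, where \<open>m'\<close> is the dimension of the span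
  (\<open>feasible_point_low_rank\<close>).

  Solving for \<open>r\<close> gives the bound of the theorem when the start is an optimal solution. Because the
  reduction applies to every feasible point, the equality of the two values for \<open>m' \<le> 2\<close>,
  where the inequality forces \<open>r \<le> 1\<close>, also holds for an infimum that is not a minimum.

  The step to the boundary also shows that the convex hull of the matrices of rank at most one is
  the whole cone: subtracting from \<open>X\<close> the right multiple of \<open>u u\<^sup>T\<close>, with \<open>u\<close> in
  the range of \<open>X\<close>, lowers the rank, so that induction writes \<open>X\<close> as a sum of such matrices. This
  takes the place of a spectral decomposition.
\<close>

section \<open>Positive semidefinite matrices\<close>

lemma symmetric_inner_mult:
  fixes X :: "real^'n^'n"
  assumes "transpose X = X"
  shows "(X *v x) \<bullet> y = x \<bullet> (X *v y)"
  by (metis assms dot_lmul_matrix transpose_matrix_vector)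

lemma psd_matrices_symmetric: "X \<in> psd_matrices \<Longrightarrow> transpose X = X"
  by (simp add: psd_matrices_def)

lemma convex_cone_psd_matrices: "convex (psd_matrices :: (real^'n^'n) set) \<and> cone (psd_matrices :: (real^'n^'n) set)"
  unfolding convex_cone
proof (intro conjI ballI allI impI)
  fix X Y :: "real^'n^'n" assume "X \<in> psd_matrices" "Y \<in> psd_matrices"
  then show "X + Y \<in> psd_matrices"
    by (auto simp: psd_matrices_def transpose_def vec_eq_iff matrix_vector_mult_add_rdistrib inner_add_right)
next
  fix X :: "real^'n^'n" and c :: real assume "X \<in> psd_matrices" "0 \<le> c"
  then show "c *\<^sub>R X \<in> psd_matrices"
    by (auto simp: psd_matrices_def transpose_def vec_eq_iff inner_scaleR_right
        simp flip: scaleR_matrix_vector_assoc)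
qed

lemma psd_matrices_add_scaleR:
  assumes "X \<in> psd_matrices" "W \<in> psd_matrices" "0 \<le> t"
  shows "X + t *\<^sub>R W \<in> psd_matrices"
  using assms convex_cone_psd_matrices unfolding convex_cone by blast

text \<open>
  The form is minimal at a zero \<open>v\<close>, so its derivative there, which is \<open>2 X v\<close>, vanishes.
\<close>

lemma psd_form_zero_imp_kernel:
  fixes X :: "real^'n^'n"
  assumes X: "X \<in> psd_matrices" and v: "v \<bullet> (X *v v) = 0"
  shows "X *v v = 0"
proof (rule ccontr)
  assume nz: "X *v v \<noteq> 0"
  define w where "w = X *v v"
  define a where "a = w \<bullet> w"
  define q where "q = w \<bullet> (X *v w)"
  have "a > 0" using nz by (simp add: a_def w_def)
  have "q \<ge> 0" using X by (simp add: q_def psd_matrices_def)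
  have "v \<bullet> (X *v w) = a"
    using symmetric_inner_mult[OF psd_matrices_symmetric[OF X], of v w] by (simp add: a_def w_def)
  then have expand: "(v + s *\<^sub>R w) \<bullet> (X *v (v + s *\<^sub>R w)) = 2 * s * a + s\<^sup>2 * q" for s
    using v by (simp add: matrix_vector_right_distrib matrix_vector_mult_scaleR inner_add_left
        inner_add_right a_def q_def power2_eq_square algebra_simps flip: w_def)
  have "2 * s * a + s\<^sup>2 * q \<ge> 0" for s
    using X by (simp add: psd_matrices_def flip: expand)
  \<comment> \<open>The parabola is negative at any small enough \<open>s < 0\<close>; \<open>s = - k\<close> is small enough.\<close>
  define k where "k = a / (q + 1)"
  have a_eq: "a = k * (q + 1)" and "k > 0"
    using \<open>a > 0\<close> \<open>q \<ge> 0\<close> by (simp_all add: k_def)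
  have "2 * (- k) * a + (- k)\<^sup>2 * q = - (k\<^sup>2 * (q + 2))"
    by (simp add: a_eq power2_eq_square algebra_simps)
  also have "\<dots> < 0"
    using \<open>k > 0\<close> \<open>q \<ge> 0\<close> by (simp add: mult_less_0_iff)
  also have "0 \<le> 2 * (- k) * a + (- k)\<^sup>2 * q"
    by fact
  finally show False by simp
qed

text \<open>
  The kernel of a symmetric matrix is the orthogonal complement of its range.
\<close>

lemma rank_plus_dim_kernel_symmetric:
  fixes X :: "real^'n^'n"
  assumes "transpose X = X"
  shows "dim {v. X *v v = 0} + rank X = CARD('n)"
proof -
  have "{y \<in> UNIV. \<forall>x\<in>range ((*v) X). orthogonal x y} = {v. X *v v = 0}"
    using symmetric_inner_mult[OF assms]
    by (auto simp: orthogonal_def) (metis inner_eq_zero_iff)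
  then show ?thesis
    using dim_subspace_orthogonal_to_vectors[of "range ((*v) X)" UNIV]
    by (simp add: rank_dim_range linear_subspace_image)
qed

lemma rank_less_if_kernel_grows:
  fixes X Y :: "real^'n^'n"
  assumes X: "transpose X = X" and Y: "transpose Y = Y"
    and sub: "\<And>v. X *v v = 0 \<Longrightarrow> Y *v v = 0" and u: "Y *v u = 0" "X *v u \<noteq> 0"
  shows "rank Y < rank X"
proof -
  have "subspace {v. Z *v v = 0}" for Z :: "real^'n^'n"
    by (auto simp: subspace_def matrix_vector_right_distrib matrix_vector_mult_scaleR)
  then have "span {v. X *v v = 0} \<subset> span {v. Y *v v = 0}"
    using sub u by (simp add: span_eq_iff[THEN iffD2]) blast
  then have "dim {v. X *v v = 0} < dim {v. Y *v v = 0}"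
    by (rule dim_psubset)
  then show ?thesis
    using rank_plus_dim_kernel_symmetric[OF X] rank_plus_dim_kernel_symmetric[OF Y] by linarith
qed

text \<open>
  Writing \<open>v = u + k\<close> with \<open>u\<close> in the range and \<open>k\<close> in the kernel of \<open>Y\<close>, the form of \<open>Z\<close> does not
  see \<open>k\<close>. This is what reduces inequalities between such forms to the range of \<open>Y\<close>, where a
  positive semidefinite \<open>Y\<close> is definite.
\<close>

lemma symmetric_form_depends_on_range_part:
  fixes Y Z :: "real^'n^'n"
  assumes Y: "transpose Y = Y" and Z: "transpose Z = Z"
    and ker: "\<And>v. Y *v v = 0 \<Longrightarrow> Z *v v = 0"
  obtains u where "u \<in> range ((*v) Y)" "v \<bullet> (Z *v v) = u \<bullet> (Z *v u)"
proof -
  have sp: "span (range ((*v) Y)) = range ((*v) Y)"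
    by (simp add: span_eq_iff linear_subspace_image)
  obtain u k where u: "u \<in> range ((*v) Y)" and k: "\<And>w. w \<in> range ((*v) Y) \<Longrightarrow> orthogonal k w"
    and v: "v = u + k"
    using orthogonal_subspace_decomp_exists[of "range ((*v) Y)" v] unfolding sp by metis
  \<comment> \<open>As \<open>k\<close> is orthogonal to \<open>Y (Y k)\<close>, symmetry gives \<open>\<bar>Y k\<bar>\<^sup>2 = 0\<close>.\<close>
  have "orthogonal k (Y *v (Y *v k))"
    using k by blast
  then have "(Y *v k) \<bullet> (Y *v k) = 0"
    by (simp add: orthogonal_def symmetric_inner_mult[OF Y])
  then have "Z *v k = 0"
    by (simp add: ker)
  then have "v \<bullet> (Z *v v) = u \<bullet> (Z *v u)"
    using symmetric_inner_mult[OF Z, of k u] by (simp add: v matrix_vector_right_distrib inner_add_left)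
  with u show thesis by (rule that)
qed

text \<open>
  The unit sphere of the range is compact and the form has no zero on it, because range and kernel
  meet only in \<open>0\<close>; the constant is the minimum of the form there.
\<close>

lemma psd_coercive_on_range:
  fixes Y :: "real^'n^'n"
  assumes Y: "Y \<in> psd_matrices"
  obtains c where "c > 0" "\<And>u. u \<in> range ((*v) Y) \<Longrightarrow> c * (norm u)\<^sup>2 \<le> u \<bullet> (Y *v u)"
proof -
  let ?R = "range ((*v) Y)"
  have subR: "subspace ?R"
    by (simp add: linear_subspace_image)
  let ?K = "?R \<inter> sphere 0 1"
  have unit: "(1 / norm u) *\<^sub>R u \<in> ?K" if "u \<in> ?R" "u \<noteq> 0" for u
    using that subspace_scale[OF subR that(1), of "1 / norm u"] by simp
  have "\<exists>c>0. \<forall>u\<in>?K. c \<le> u \<bullet> (Y *v u)"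
  proof (cases "?K = {}")
    case True
    then show ?thesis by (intro exI[of _ 1]) auto
  next
    case False
    have "compact ?K"
      by (intro closed_Int_compact closed_subspace subR) auto
    moreover have "continuous_on ?K (\<lambda>u. u \<bullet> (Y *v u))"
      by (intro continuous_intros linear_continuous_on matrix_vector_mul_bounded_linear)
    ultimately obtain u where u: "u \<in> ?K" and le: "\<forall>v\<in>?K. u \<bullet> (Y *v u) \<le> v \<bullet> (Y *v v)"
      using continuous_attains_inf[of ?K] False by blast
    have "u \<bullet> (Y *v u) \<noteq> 0"
    proof
      assume "u \<bullet> (Y *v u) = 0"
      then have 0: "Y *v u = 0" by (rule psd_form_zero_imp_kernel[OF Y])
      obtain a where "u = Y *v a" using u by auto
      then have "u \<bullet> u = a \<bullet> (Y *v u)"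
        using symmetric_inner_mult[OF psd_matrices_symmetric[OF Y]] by simp
      with 0 u show False by (auto simp: norm_eq_sqrt_inner)
    qed
    moreover have "u \<bullet> (Y *v u) \<ge> 0"
      using Y by (simp add: psd_matrices_def)
    ultimately show ?thesis using le by (intro exI[of _ "u \<bullet> (Y *v u)"]) auto
  qed
  then obtain c where c: "c > 0" "\<And>u. u \<in> ?K \<Longrightarrow> c \<le> u \<bullet> (Y *v u)"
    by blast
  have "c * (norm u)\<^sup>2 \<le> u \<bullet> (Y *v u)" if "u \<in> ?R" for u
  proof (cases "u = 0")
    case False
    have "c \<le> ((1 / norm u) *\<^sub>R u) \<bullet> (Y *v ((1 / norm u) *\<^sub>R u))"
      using c(2)[OF unit[OF that False]] .
    also have "\<dots> = (u \<bullet> (Y *v u)) / (norm u)\<^sup>2"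
      by (simp add: matrix_vector_mult_scaleR power2_eq_square)
    finally show ?thesis
      using False by (simp add: field_simps)
  qed simp
  with c(1) show thesis by (rule that)
qed

section \<open>Moving to the boundary lowers the rank\<close>

text \<open>
  A matrix is in the relative interior of the face of the cone made up of the matrices with at least
  its kernel: on its range it is bounded below by a positive constant, which outweighs a small
  multiple of \<open>W\<close>.
\<close>

lemma psd_perturb:
  fixes Y W :: "real^'n^'n"
  assumes Y: "Y \<in> psd_matrices" and W: "transpose W = W"
    and ker: "\<And>v. Y *v v = 0 \<Longrightarrow> W *v v = 0"
  obtains e where "e > 0" "Y + e *\<^sub>R W \<in> psd_matrices"
proof -
  obtain c where c: "c > 0" "\<And>u. u \<in> range ((*v) Y) \<Longrightarrow> c * (norm u)\<^sup>2 \<le> u \<bullet> (Y *v u)"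
    using psd_coercive_on_range[OF Y] by blast
  obtain B where B: "B > 0" "\<And>u. norm (W *v u) \<le> norm u * B"
    using bounded_linear.pos_bounded[OF matrix_vector_mul_bounded_linear[of W]] by blast
  define Z where "Z = Y + (c / B) *\<^sub>R W"
  have Zsym: "transpose Z = Z"
    using W psd_matrices_symmetric[OF Y] by (auto simp: Z_def transpose_def vec_eq_iff)
  have Zmul: "Z *v v = Y *v v + (c / B) *\<^sub>R (W *v v)" for v
    by (simp add: Z_def matrix_vector_mult_add_rdistrib flip: scaleR_matrix_vector_assoc)
  have "0 \<le> v \<bullet> (Z *v v)" for v
  proof -
    have "Z *v k = 0" if "Y *v k = 0" for k
      using that ker by (simp add: Zmul)
    then obtain u where u: "u \<in> range ((*v) Y)" "v \<bullet> (Z *v v) = u \<bullet> (Z *v u)"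
      using symmetric_form_depends_on_range_part[OF psd_matrices_symmetric[OF Y] Zsym] by blast
    have "\<bar>u \<bullet> (W *v u)\<bar> \<le> norm u * (norm u * B)"
      using Cauchy_Schwarz_ineq2[of u "W *v u"] mult_left_mono[OF B(2)[of u], of "norm u"] by simp
    then have "(c / B) * \<bar>u \<bullet> (W *v u)\<bar> \<le> (c / B) * (norm u * (norm u * B))"
      by (rule mult_left_mono) (use c B in simp)
    also have "\<dots> = c * (norm u)\<^sup>2"
      using B by (simp add: power2_eq_square)
    finally have "(c / B) * \<bar>u \<bullet> (W *v u)\<bar> \<le> u \<bullet> (Y *v u)"
      using c(2)[OF u(1)] by linarith
    moreover have "\<bar>(c / B) * (u \<bullet> (W *v u))\<bar> = (c / B) * \<bar>u \<bullet> (W *v u)\<bar>"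
      using c B by (simp add: abs_mult)
    moreover have "u \<bullet> (Z *v u) = u \<bullet> (Y *v u) + (c / B) * (u \<bullet> (W *v u))"
      by (simp add: Zmul inner_add_right)
    ultimately show ?thesis
      using u(2) by linarith
  qed
  then have "Z \<in> psd_matrices"
    using Zsym by (simp add: psd_matrices_def)
  then show thesis
    using that[of "c / B"] c B by (simp add: Z_def)
qed

text \<open>
  The last point \<open>Y\<close> of the cone on the ray from \<open>X\<close> must have a larger kernel than \<open>X\<close>: otherwise
  \<open>W\<close> would vanish on the kernel of \<open>Y\<close>, and \<open>psd_perturb\<close> would extend the ray beyond \<open>Y\<close>.
\<close>

lemma psd_move_to_lower_rank:
  fixes X W :: "real^'n^'n"
  assumes X: "X \<in> psd_matrices" and W: "transpose W = W"
    and ker: "\<And>v. X *v v = 0 \<Longrightarrow> W *v v = 0"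
    and "W \<notin> psd_matrices"
  obtains t where "t \<ge> 0" "X + t *\<^sub>R W \<in> psd_matrices" "rank (X + t *\<^sub>R W) < rank X"
proof -
  define S where "S = {t. 0 \<le> t \<and> X + t *\<^sub>R W \<in> psd_matrices}"
  have sym: "transpose (X + t *\<^sub>R W) = X + t *\<^sub>R W" for t
    using W psd_matrices_symmetric[OF X] by (auto simp: transpose_def vec_eq_iff)
  have mul: "(X + t *\<^sub>R W) *v v = X *v v + t *\<^sub>R (W *v v)" for t v
    by (simp add: matrix_vector_mult_add_rdistrib flip: scaleR_matrix_vector_assoc)
  have S_eq: "S = {0..} \<inter> (\<Inter>v. {t. 0 \<le> v \<bullet> (X *v v) + t * (v \<bullet> (W *v v))})"
    using sym by (auto simp: S_def psd_matrices_def mul inner_add_right)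
  \<comment> \<open>Only a vector on which the form of \<open>W\<close> is negative makes the ray leave the cone.\<close>
  obtain v0 where v0: "v0 \<bullet> (W *v v0) < 0"
    using \<open>W \<notin> psd_matrices\<close> W by (auto simp: psd_matrices_def not_le)
  have "t \<le> (v0 \<bullet> (X *v v0)) / - (v0 \<bullet> (W *v v0))" if "t \<in> S" for t
  proof -
    have "0 \<le> v0 \<bullet> (X *v v0) + t * (v0 \<bullet> (W *v v0))"
      using that by (simp add: S_eq)
    then show ?thesis
      using v0 by (simp add: field_simps)
  qed
  then have "S \<subseteq> {0..(v0 \<bullet> (X *v v0)) / - (v0 \<bullet> (W *v v0))}"
    by (auto simp: S_def)
  then have "bounded S"
    using bounded_subset bounded_closed_interval by blast
  moreover have "closed S"
    unfolding S_eq by (intro closed_Int closed_INT ballI closed_Collect_le continuous_intros closed_atLeast)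
  moreover have "0 \<in> S"
    using X by (simp add: S_def)
  ultimately obtain t where t: "t \<in> S" "\<And>s. s \<in> S \<Longrightarrow> s \<le> t"
    using compact_attains_sup[of S] by (auto simp: compact_eq_bounded_closed)
  define Y where "Y = X + t *\<^sub>R W"
  have Y: "Y \<in> psd_matrices"
    using t(1) by (simp add: S_def Y_def)
  have "\<exists>u. Y *v u = 0 \<and> X *v u \<noteq> 0"
  proof (rule ccontr)
    assume "\<nexists>u. Y *v u = 0 \<and> X *v u \<noteq> 0"
    then have "\<And>v. Y *v v = 0 \<Longrightarrow> W *v v = 0"
      using ker by blast
    then obtain e where "e > 0" "Y + e *\<^sub>R W \<in> psd_matrices"
      using psd_perturb[OF Y W] by blast
    then have "t + e \<in> S"
      using t(1) by (simp add: S_def Y_def scaleR_add_left add.assoc)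
    with t(2) \<open>e > 0\<close> show False by fastforce
  qed
  then obtain u where u: "Y *v u = 0" "X *v u \<noteq> 0" by blast
  have "rank Y < rank X"
    by (rule rank_less_if_kernel_grows[OF psd_matrices_symmetric[OF X] psd_matrices_symmetric[OF Y] _ u])
      (simp add: Y_def mul ker)
  with t(1) Y show thesis
    by (intro that[of t]) (auto simp: S_def Y_def)
qed

section \<open>Outer products\<close>

definition outer_product :: "real^'n \<Rightarrow> real^'n \<Rightarrow> real^'n^'n" where
  "outer_product u v = (\<chi> i j. u $ i * v $ j)"

lemma outer_product_mult: "outer_product u v *v w = (v \<bullet> w) *\<^sub>R u"
  by (simp add: outer_product_def vec_eq_iff matrix_vector_mult_def inner_vec_def
      sum_distrib_left mult_ac)

lemma transpose_outer_product: "transpose (outer_product u v) = outer_product v u"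
  by (simp add: outer_product_def transpose_def vec_eq_iff)

lemma inner_outer_product:
  "outer_product u v \<bullet> outer_product x y = (u \<bullet> x) * (v \<bullet> y)"
  by (simp add: outer_product_def inner_vec_def sum_product mult_ac)

lemma outer_product_self_in_rank_one_domain:
  assumes "0 \<le> t"
  shows "t *\<^sub>R outer_product u u \<in> rank_one_domain"
proof -
  have mul: "(t *\<^sub>R outer_product u u) *v v = (t * (u \<bullet> v)) *\<^sub>R u" for v
    by (simp add: outer_product_mult flip: scaleR_matrix_vector_assoc)
  have "dim (range ((*v) (t *\<^sub>R outer_product u u))) \<le> card {u}"
    by (rule dim_le_card) (auto simp: mul span_base span_scale)
  then have "rank (t *\<^sub>R outer_product u u) \<le> 1"
    by (simp add: rank_dim_range)
  moreover have "transpose (t *\<^sub>R outer_product u u) = t *\<^sub>R outer_product u u"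
    by (simp add: outer_product_def transpose_def vec_eq_iff)
  moreover have "0 \<le> v \<bullet> ((t *\<^sub>R outer_product u u) *v v)" for v
  proof -
    have "v \<bullet> ((t *\<^sub>R outer_product u u) *v v) = t * (u \<bullet> v)\<^sup>2"
      by (simp add: mul inner_commute power2_eq_square)
    then show ?thesis using assms by simp
  qed
  ultimately show ?thesis
    by (simp add: rank_one_domain_def psd_matrices_def)
qed

lemma cone_rank_one_domain: "cone (rank_one_domain :: (real^'n^'n) set)"
  unfolding cone_def
proof (intro ballI allI impI)
  fix X :: "real^'n^'n" and c :: real
  assume X: "X \<in> rank_one_domain" and c: "c \<ge> 0"
  have "range ((*v) (c *\<^sub>R X)) \<subseteq> range ((*v) X)"
    by (auto simp: matrix_vector_mult_scaleR[symmetric] simp flip: scaleR_matrix_vector_assoc)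
  then have "rank (c *\<^sub>R X) \<le> rank X"
    by (simp add: rank_dim_range dim_subset)
  then show "c *\<^sub>R X \<in> rank_one_domain"
    using X c convex_cone_psd_matrices unfolding convex_cone
    by (auto simp: rank_one_domain_def intro: order_trans)
qed

text \<open>
  The direction \<open>- u u\<^sup>T\<close> with \<open>u\<close> in the range of \<open>X\<close> vanishes on the kernel of \<open>X\<close> and leaves the
  cone, so a multiple of \<open>u u\<^sup>T\<close> can be split off with a loss of rank. The hull of a cone is
  closed under addition, so the two parts can be put together again.
\<close>

lemma psd_in_convex_hull_rank_one:
  assumes "X \<in> psd_matrices"
  shows "X \<in> convex hull rank_one_domain"
  using assms
proof (induction "rank X" arbitrary: X rule: less_induct)
  case less
  show ?case
  proof (cases "X = 0")
    case True
    then have "X \<in> rank_one_domain"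
      using less.prems by (simp add: rank_one_domain_def)
    then show ?thesis by (rule hull_inc)
  next
    case False
    then obtain a where a: "X *v a \<noteq> 0"
      by (metis matrix_eq matrix_vector_mult_0)
    define u where "u = X *v a"
    define W where "W = - outer_product u u"
    have W_mul: "W *v v = - (u \<bullet> v) *\<^sub>R u" for v
      by (simp add: W_def outer_product_mult matrix_vector_mult_diff_rdistrib[of 0, simplified])
    have "transpose W = W"
      by (simp add: W_def outer_product_def transpose_def vec_eq_iff)
    moreover have "W *v v = 0" if "X *v v = 0" for v
      using that symmetric_inner_mult[OF psd_matrices_symmetric[OF less.prems], of a v]
      by (simp add: W_mul u_def)
    moreover have "u \<bullet> (W *v u) < 0"
      using a by (simp add: W_mul u_def)
    then have "W \<notin> psd_matrices"
      by (auto simp: psd_matrices_def not_le intro: exI[of _ u])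
    ultimately obtain t where t: "t \<ge> 0" "X + t *\<^sub>R W \<in> psd_matrices" "rank (X + t *\<^sub>R W) < rank X"
      using psd_move_to_lower_rank[OF less.prems] by blast
    have "X + t *\<^sub>R W \<in> convex hull rank_one_domain"
      by (rule less.hyps[OF t(3,2)])
    moreover have "t *\<^sub>R outer_product u u \<in> convex hull rank_one_domain"
      by (intro hull_inc outer_product_self_in_rank_one_domain t)
    ultimately have "(X + t *\<^sub>R W) + t *\<^sub>R outer_product u u \<in> convex hull rank_one_domain"
      using convex_cone[of "convex hull rank_one_domain"] cone_convex_hull[OF cone_rank_one_domain]
      by (auto simp: convex_convex_hull)
    then show ?thesis by (simp add: W_def)
  qed
qed

lemma convex_hull_rank_one_domain: "convex hull rank_one_domain = psd_matrices"
proof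
  show "convex hull rank_one_domain \<subseteq> psd_matrices"
    by (rule hull_minimal) (use convex_cone_psd_matrices in \<open>auto simp: rank_one_domain_def\<close>)
qed (auto intro: psd_in_convex_hull_rank_one)

section \<open>Counting dimensions\<close>

lemma card_orthogonal_family_le_dim:
  fixes f :: "'i \<Rightarrow> 'a::euclidean_space"
  assumes "\<And>p. p \<in> P \<Longrightarrow> f p \<in> U"
    and orth: "\<And>p q. p \<in> P \<Longrightarrow> q \<in> P \<Longrightarrow> p \<noteq> q \<Longrightarrow> f p \<bullet> f q = 0"
    and nz: "\<And>p. p \<in> P \<Longrightarrow> f p \<noteq> 0"
  shows "card P \<le> dim U"
proof -
  have inj: "inj_on f P"
    by (rule inj_onI) (metis orth nz inner_eq_zero_iff)
  have "independent (f ` P)"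
    by (rule pairwise_orthogonal_independent) (use orth nz in \<open>auto simp: pairwise_def orthogonal_def\<close>)
  then have "card (f ` P) \<le> dim U"
    by (rule independent_card_le_dim[rotated]) (use assms in auto)
  then show ?thesis by (simp add: card_image[OF inj])
qed

text \<open>
  The orthogonal complement of \<open>S\<close> is too large to meet \<open>U\<close> only in \<open>0\<close>.
\<close>

lemma orthogonal_vector_in_larger_subspace:
  fixes U :: "'a::euclidean_space set"
  assumes U: "subspace U" and less: "dim S < dim U"
  obtains w where "w \<in> U" "w \<noteq> 0" "\<And>x. x \<in> S \<Longrightarrow> x \<bullet> w = 0"
proof -
  define V where "V = {y \<in> UNIV. \<forall>x\<in>span S. orthogonal x y}"
  have V: "subspace V"
    by (simp add: V_def subspace_orthogonal_to_vectors)
  have "dim V + dim S = DIM('a)"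
    using dim_subspace_orthogonal_to_vectors[of "span S" UNIV] by (simp add: V_def)
  moreover have "dim {x + y |x y. x \<in> U \<and> y \<in> V} + dim (U \<inter> V) = dim U + dim V"
    by (rule dim_sums_Int[OF U V])
  moreover have "dim {x + y |x y. x \<in> U \<and> y \<in> V} \<le> DIM('a)"
    by (rule dim_subset_UNIV)
  ultimately have "dim (U \<inter> V) \<noteq> 0"
    using less by linarith
  then obtain w where "w \<in> U \<inter> V" "w \<noteq> 0"
    by (auto simp: dim_eq_0)
  then show thesis
    by (intro that[of w]) (auto simp: V_def orthogonal_def span_base)
qed

text \<open>
  For an orthonormal basis \<open>b\<close> of the range of \<open>X\<close>, the matrices
  \<open>b\<^sub>i b\<^sub>j\<^sup>T + b\<^sub>j b\<^sub>i\<^sup>T\<close> with \<open>i \<le> j\<close> are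
  pairwise orthogonal, and they vanish on the kernel of \<open>X\<close>.
\<close>

lemma dim_symmetric_with_kernel_ge:
  fixes X :: "real^'n^'n"
  assumes X: "transpose X = X"
  shows "rank X * (rank X + 1) \<le> 2 * dim {W. transpose W = W \<and> (\<forall>v. X *v v = 0 \<longrightarrow> W *v v = 0)}"
    (is "_ \<le> 2 * dim ?U")
proof -
  let ?r = "rank X"
  have "subspace (range ((*v) X))"
    by (simp add: linear_subspace_image)
  then obtain B where B: "B \<subseteq> range ((*v) X)" "pairwise orthogonal B" "\<And>x. x \<in> B \<Longrightarrow> norm x = 1"
    "independent B" "card B = ?r"
    using orthonormal_basis_subspace[of "range ((*v) X)"] by (metis rank_dim_range)
  have "finite B" using B(4) independent_imp_finite by blast
  then obtain b where b: "bij_betw b {0..<?r} B"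
    using ex_bij_betw_nat_finite[of B] B(5) by auto
  have bB: "b i \<in> B" if "i < ?r" for i
    using bij_betwE[OF b] that by auto
  have bb: "b i \<bullet> b j = (if i = j then 1 else 0)" if "i < ?r" "j < ?r" for i j
  proof (cases "i = j")
    case True
    then show ?thesis using B(3)[OF bB[OF that(1)]] by (simp add: norm_eq_1)
  next
    case False
    then have "b i \<noteq> b j"
      using inj_onD[OF bij_betw_imp_inj_on[OF b], of i j] that by auto
    then show ?thesis using False B(2) bB that by (auto simp: pairwise_def orthogonal_def)
  qed
  have bker: "b i \<bullet> v = 0" if i: "i < ?r" and "X *v v = 0" for i v
  proof -
    obtain a where "b i = X *v a" using B(1) bB[OF i] by auto
    then show ?thesis using symmetric_inner_mult[OF X, of a v] that by simp
  qed
  define E where "E = (\<lambda>(j, i). outer_product (b i) (b j) + outer_product (b j) (b i))"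
  define P where "P = Sigma {..<?r} (\<lambda>j. {..j})"
  have inner_E: "E (j, i) \<bullet> E (l, k)
      = 2 * ((b i \<bullet> b k) * (b j \<bullet> b l) + (b i \<bullet> b l) * (b j \<bullet> b k))" for i j k l
    by (simp add: E_def inner_add_left inner_add_right inner_outer_product)
  have "card P \<le> dim ?U"
  proof (rule card_orthogonal_family_le_dim[where f = E])
    fix p assume "p \<in> P"
    then obtain i j where p: "p = (j, i)" "i \<le> j" "j < ?r" by (auto simp: P_def)
    have "transpose (E p) = E p"
      by (simp add: p E_def outer_product_def transpose_def vec_eq_iff)
    moreover have "E p *v v = 0" if "X *v v = 0" for v
      using p that by (simp add: E_def matrix_vector_mult_add_rdistrib outer_product_mult bker)
    ultimately show "E p \<in> ?U" by blast
    have "E p \<bullet> E p \<noteq> 0"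
      using p by (simp add: inner_E bb)
    then show "E p \<noteq> 0" by auto
  next
    fix p q assume "p \<in> P" "q \<in> P" "p \<noteq> q"
    then show "E p \<bullet> E q = 0"
      by (auto simp: P_def inner_E bb split: if_splits)
  qed
  moreover have "2 * card P = ?r * (?r + 1)"
  proof -
    have "2 * (\<Sum>j<n. Suc j) = n * (n + 1)" for n
      by (induction n) auto
    then show ?thesis by (simp add: P_def)
  qed
  ultimately show ?thesis by linarith
qed

section \<open>Reducing the rank of a feasible point\<close>

lemma optimal_value_bounded_below:
  assumes "optimal_value D m A bl bu > -\<infinity>"
  obtains c where "\<And>Y. Y \<in> feasible_set D m A bl bu \<Longrightarrow> c \<le> A 0 \<bullet> Y"
proof -
  obtain c where c: "ereal c < optimal_value D m A bl bu"
    using ereal_dense2[OF assms] by blast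
  have "c \<le> A 0 \<bullet> Y" if "Y \<in> feasible_set D m A bl bu" for Y
  proof -
    have "optimal_value D m A bl bu \<le> ereal (A 0 \<bullet> Y)"
      unfolding optimal_value_def using that by (rule INF_lower)
    with c have "ereal c < ereal (A 0 \<bullet> Y)"
      by (rule less_le_trans)
    then show ?thesis by simp
  qed
  then show thesis by (rule that)
qed

lemma feasible_set_transfer:
  assumes "X \<in> feasible_set D m A bl bu" "Y \<in> D'" "\<And>i. i \<in> {1..m} \<Longrightarrow> A i \<bullet> Y = A i \<bullet> X"
  shows "Y \<in> feasible_set D' m A bl bu"
  using assms by (auto simp: feasible_set_def)

text \<open>
  The rank drops as long as the space of directions \<open>U\<close> is larger than the span of the constraint
  matrices. Boundedness of the objective rules out that the improving direction is a ray of the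
  feasible set, on which no rank would ever be lost.
\<close>

lemma feasible_point_low_rank:
  fixes A :: "nat \<Rightarrow> real^'n^'n"
  assumes bdd: "optimal_value psd_matrices m A bl bu > -\<infinity>"
    and "X \<in> feasible_set psd_matrices m A bl bu"
  shows "\<exists>Y \<in> feasible_set psd_matrices m A bl bu. A 0 \<bullet> Y \<le> A 0 \<bullet> X
           \<and> rank Y * (rank Y + 1) \<le> 2 * dim (A ` {1..m})"
  using assms(2)
proof (induction "rank X" arbitrary: X rule: less_induct)
  case less
  let ?F = "feasible_set psd_matrices m A bl bu"
  have X: "X \<in> psd_matrices"
    using less.prems by (simp add: feasible_set_def)
  show ?case
  proof (cases "rank X * (rank X + 1) \<le> 2 * dim (A ` {1..m})")
    case True
    with less.prems show ?thesis by blast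
  next
    case False
    define U where "U = {W. transpose W = W \<and> (\<forall>v. X *v v = 0 \<longrightarrow> W *v v = 0)}"
    have U: "subspace U"
      unfolding U_def subspace_def
      by (auto simp: transpose_def vec_eq_iff matrix_vector_mult_add_rdistrib
          simp flip: scaleR_matrix_vector_assoc)
    have "dim (A ` {1..m}) < dim U"
      using False dim_symmetric_with_kernel_ge[OF psd_matrices_symmetric[OF X]] by (simp add: U_def)
    then obtain W0 where W0: "W0 \<in> U" "W0 \<noteq> 0" "\<And>i. i \<in> {1..m} \<Longrightarrow> A i \<bullet> W0 = 0"
      using orthogonal_vector_in_larger_subspace[OF U] by (metis image_eqI)
    obtain c where c: "\<And>Y. Y \<in> ?F \<Longrightarrow> c \<le> A 0 \<bullet> Y"
      using optimal_value_bounded_below[OF bdd] by blast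
    have feas: "X + t *\<^sub>R W \<in> ?F" if "X + t *\<^sub>R W \<in> psd_matrices"
      "\<And>i. i \<in> {1..m} \<Longrightarrow> A i \<bullet> W = 0" for t W
      using that by (intro feasible_set_transfer[OF less.prems]) (auto simp: inner_add_right)
    have psd_dir: "A 0 \<bullet> W \<ge> 0" if W: "W \<in> psd_matrices" "\<And>i. i \<in> {1..m} \<Longrightarrow> A i \<bullet> W = 0" for W
    proof (rule ccontr)
      assume neg: "\<not> A 0 \<bullet> W \<ge> 0"
      \<comment> \<open>The step at which the objective has the value \<open>c - 1\<close>, below its lower bound \<open>c\<close>.\<close>
      define t where "t = (A 0 \<bullet> X - c + 1) / - (A 0 \<bullet> W)"
      have "t \<ge> 0"
        using neg c[OF less.prems] unfolding t_def by (intro divide_nonneg_nonneg) auto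
      then have "c \<le> A 0 \<bullet> (X + t *\<^sub>R W)"
        by (intro c feas psd_matrices_add_scaleR X W) auto
      also have "\<dots> = c - 1"
      proof -
        have "t * (A 0 \<bullet> W) = - (A 0 \<bullet> X - c + 1)"
          using neg by (simp add: t_def)
        then show ?thesis by (simp add: inner_add_right)
      qed
      finally show False by simp
    qed
    have "\<exists>W\<in>U. W \<notin> psd_matrices \<and> A 0 \<bullet> W \<le> 0 \<and> (\<forall>i\<in>{1..m}. A i \<bullet> W = 0)"
    proof -
      have negU: "- W0 \<in> U" using subspace_neg[OF U W0(1)] .
      have "W0 \<notin> psd_matrices \<or> - W0 \<notin> psd_matrices"
      proof (rule ccontr)
        assume "\<not> ?thesis"
        then have p: "W0 \<in> psd_matrices" "- W0 \<in> psd_matrices" by auto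
        have "W0 *v v = 0" for v
        proof (rule psd_form_zero_imp_kernel[OF p(1)])
          have "(- W0) *v v = - (W0 *v v)"
            using matrix_vector_mult_diff_rdistrib[of 0 W0 v] by simp
          then have "v \<bullet> (W0 *v v) \<le> 0"
            using p(2) by (auto simp: psd_matrices_def dest!: spec[of _ v])
          moreover have "v \<bullet> (W0 *v v) \<ge> 0"
            using p(1) by (simp add: psd_matrices_def)
          ultimately show "v \<bullet> (W0 *v v) = 0" by simp
        qed
        then show False using W0(2) by (metis matrix_eq matrix_vector_mult_0)
      qed
      moreover have "A 0 \<bullet> W0 \<ge> 0" if "W0 \<in> psd_matrices"
        using psd_dir[OF that] W0(3) by blast
      moreover have "A 0 \<bullet> W0 \<le> 0" if "- W0 \<in> psd_matrices"
        using psd_dir[OF that] W0(3) by simp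
      \<comment> \<open>If both signs leave the cone, take the one that does not increase the objective. If one of
        them stays, the objective does not decrease along it, so the other one serves.\<close>
      ultimately consider "W0 \<notin> psd_matrices" "A 0 \<bullet> W0 \<le> 0" | "- W0 \<notin> psd_matrices" "A 0 \<bullet> (- W0) \<le> 0"
        by fastforce
      then show ?thesis
        using W0 negU by cases auto
    qed
    then obtain W where W: "W \<in> U" "W \<notin> psd_matrices" "A 0 \<bullet> W \<le> 0" "\<And>i. i \<in> {1..m} \<Longrightarrow> A i \<bullet> W = 0"
      by blast
    obtain t where t: "t \<ge> 0" "X + t *\<^sub>R W \<in> psd_matrices" "rank (X + t *\<^sub>R W) < rank X"
      using psd_move_to_lower_rank[OF X _ _ W(2)] W(1) by (auto simp: U_def)
    obtain Y where "Y \<in> ?F" "A 0 \<bullet> Y \<le> A 0 \<bullet> (X + t *\<^sub>R W)"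
      "rank Y * (rank Y + 1) \<le> 2 * dim (A ` {1..m})"
      using less.hyps[OF t(3) feas[OF t(2) W(4)]] by blast
    moreover have "A 0 \<bullet> (X + t *\<^sub>R W) \<le> A 0 \<bullet> X"
      using t(1) W(3) by (simp add: inner_add_right mult_nonneg_nonpos)
    ultimately show ?thesis by (meson order_trans)
  qed
qed

text \<open>
  Completing the square turns the hypothesis into \<open>(r + 1/2)\<^sup>2 \<le> 2 d + 1/4\<close>; the floor is harmless as
  \<open>r\<close> is an integer.
\<close>

lemma rank_bound_of_triangular_bound:
  fixes r d :: nat
  assumes "r * (r + 1) \<le> 2 * d"
  shows "int r \<le> 1 + \<lfloor>sqrt (2 * real d + 1 / 4) - 3 / 2\<rfloor>"
proof -
  have "real (r * (r + 1)) \<le> real (2 * d)"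
    using assms by (rule of_nat_mono)
  then have "real r + 1 / 2 \<le> sqrt (2 * real d + 1 / 4)"
    by (intro real_le_rsqrt) (simp add: power2_eq_square field_simps)
  then have "int r - 1 \<le> \<lfloor>sqrt (2 * real d + 1 / 4) - 3 / 2\<rfloor>"
    by (simp add: le_floor_iff)
  then show ?thesis by simp
qed

theorem corollary3:
  fixes A :: "nat \<Rightarrow> real^'n^'n" and m :: nat and bl bu :: "nat \<Rightarrow> ereal"
  assumes "\<And>i. i \<le> m \<Longrightarrow> transpose (A i) = A i"
    and "\<And>i. i \<in> {1..m} \<Longrightarrow> bl i \<le> bu i"
  defines "D \<equiv> rank_one_domain :: (real^'n^'n) set"
    and "mt \<equiv> dim (span (A ` {1..m}))"
  shows "convex hull D = psd_matrices
    \<and> (optimal_value (convex hull D) m A bl bu > -\<infinity> \<and> attains_minimum (convex hull D) m A bl bu \<longrightarrow>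
        (\<exists>X. optimal_solution (convex hull D) m A bl bu X \<and>
             int (rank X) \<le> 1 + \<lfloor>sqrt (2 * real mt + 1 / 4) - 3 / 2\<rfloor>))
    \<and> (mt \<le> 2 \<and> optimal_value (convex hull D) m A bl bu > -\<infinity> \<longrightarrow>
        optimal_value (convex hull D) m A bl bu = optimal_value D m A bl bu)"
proof (intro conjI impI; (elim conjE)?)
  have mt: "mt = dim (A ` {1..m})"
    by (simp add: mt_def)
  show hull: "convex hull D = psd_matrices"
    by (simp add: D_def convex_hull_rank_one_domain)
  {
    assume "optimal_value (convex hull D) m A bl bu > -\<infinity>" "attains_minimum (convex hull D) m A bl bu"
    then obtain X where X: "X \<in> feasible_set psd_matrices m A bl bu"
      "\<And>Y. Y \<in> feasible_set psd_matrices m A bl bu \<Longrightarrow> A 0 \<bullet> X \<le> A 0 \<bullet> Y"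
      and bdd: "optimal_value psd_matrices m A bl bu > -\<infinity>"
      by (auto simp: hull attains_minimum_def optimal_solution_def is_arg_min_linorder)
    obtain Y where Y: "Y \<in> feasible_set psd_matrices m A bl bu" "A 0 \<bullet> Y \<le> A 0 \<bullet> X"
      "rank Y * (rank Y + 1) \<le> 2 * mt"
      using feasible_point_low_rank[OF bdd X(1)] unfolding mt by blast
    have "optimal_solution (convex hull D) m A bl bu Y"
      using X(2) Y(1,2) by (force simp: hull optimal_solution_def is_arg_min_linorder)
    then show "\<exists>X. optimal_solution (convex hull D) m A bl bu X \<and>
             int (rank X) \<le> 1 + \<lfloor>sqrt (2 * real mt + 1 / 4) - 3 / 2\<rfloor>"
      using rank_bound_of_triangular_bound[OF Y(3)] by blast
  }
  {
    assume "mt \<le> 2" and "optimal_value (convex hull D) m A bl bu > -\<infinity>"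
    then have bdd: "optimal_value psd_matrices m A bl bu > -\<infinity>"
      by (simp add: hull)
    have "optimal_value psd_matrices m A bl bu = optimal_value D m A bl bu"
    proof (rule antisym)
      show "optimal_value psd_matrices m A bl bu \<le> optimal_value D m A bl bu"
        unfolding optimal_value_def
        by (rule INF_superset_mono) (auto simp: feasible_set_def D_def rank_one_domain_def)
      show "optimal_value D m A bl bu \<le> optimal_value psd_matrices m A bl bu"
        unfolding optimal_value_def
      proof (rule INF_mono)
        fix X assume "X \<in> feasible_set psd_matrices m A bl bu"
        then obtain Y where Y: "Y \<in> feasible_set psd_matrices m A bl bu" "A 0 \<bullet> Y \<le> A 0 \<bullet> X"
          "rank Y * (rank Y + 1) \<le> 2 * mt"
          using feasible_point_low_rank[OF bdd] unfolding mt by blast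
        have "rank Y \<le> 1"
        proof (rule ccontr)
          assume "\<not> rank Y \<le> 1"
          then have "2 * 3 \<le> rank Y * (rank Y + 1)"
            by (intro mult_le_mono) auto
          with Y(3) \<open>mt \<le> 2\<close> show False by linarith
        qed
        then have "Y \<in> feasible_set D m A bl bu"
          using Y(1) by (auto simp: feasible_set_def D_def rank_one_domain_def)
        with Y(2) show "\<exists>Y\<in>feasible_set D m A bl bu. ereal (A 0 \<bullet> Y) \<le> ereal (A 0 \<bullet> X)"
          by auto
      qed
    qed
    then show "optimal_value (convex hull D) m A bl bu = optimal_value D m A bl bu"
      by (simp add: hull)
  }
qed

end
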